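(* There is no $1$-dependent $4$-coloring of $\mathscr S^3_{(1,1,\infty)}$ (and hence none of $\mathscr S^3_{(1,2,\infty)}$) which satisfies both of the following conditions: (i) the coloring is invariant in law under permutations of the colors; (ii) the restriction of the coloring to any path is distributed according to $P^*$ (with $q=4$), i.e. for every path of distinct, consecutively adjacent vertices $u_1,\dots,u_n$ and every $\mathbf x\in[4]^n$, the probability that the colors of $u_1,\dots,u_n$ are $x_1,\dots,x_n$ equals $P^*(\mathbf x)$.
   Context: $[q]=\{1,\dots,q\}$. For $m,n\in\{1,2,\dots\}$, $\mathscr S^3_{(m,n,\infty)}$ is the graph with a distinguished vertex $v_0$ and three rays emanating from $v_0$: $(v_{11},\dots,v_{1m})$, $(v_{21},\dots,v_{2n})$ and the infinite ray $(v_{31},v_{32},\dots)$; the edges are $v_0v_{i1}$ and $v_{ij}v_{i,j+1}$. For a simple graph $G=(V,E)$, a process $X=(X_v)_{v\in V}$ is a (proper) $q$-coloring if each $X_v\in[q]$ and almost surely $X_u\neq X_v$ whenever $u,v$ are neighbors; it is $1$-dependent if its restrictions to two subsets of $V$ are independent whenever these subsets are at graph distance larger than $1$. It is invariant in law under permutations of the colors if $(\sigma(X_v))_{v\in V}$ has the same law as $X$ for every permutation $\sigma$ of $[q]$. The function $P^*$: let $C(n)=T_n(\sqrt q/2)$ for $n\ge0$, extended to negative integers by $C(-n)=C(n)$, and $D(n)=\sqrt q\,U_{n-1}(\sqrt q/2)$ for $n\ge1$, where $T_n,U_n$ are the Chebyshev polynomials of the first and second kind. Set $P^*(\emptyset)=1$,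 $P^*(\mathbf x)=0$ if $\mathbf x\in[q]^n$ is not proper (i.e. $x_i=x_{i+1}$ for some $i$), and for proper $\mathbf x\in[q]^n$, $n\ge1$, $$P^*(\mathbf x)=\frac1{D(n+1)}\sum_{j=1}^nC(n-2j+1)\,P^*(\widehat{\mathbf x}_j),$$ where $\widehat{\mathbf x}_j$ is obtained from $\mathbf x$ by deleting its $j$th entry. (For $q=4$: $C\equiv1$ and $D(n)=2n$.) For $q\ge4$ these are the cylinder probabilities of a stationary $1$-dependent $q$-coloring of $\mathbb Z$. *)

theory Defs
  imports "HOL-Probability.Probability" "HOL-Library.Extended_Nat"
begin

section \<open>Chebyshev polynomials and the cylinder function\<close>

fun cheb_T :: "nat \<Rightarrow> real \<Rightarrow> real" where
  "cheb_T 0 x = 1"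
| "cheb_T (Suc 0) x = x"
| "cheb_T (Suc (Suc n)) x = 2 * x * cheb_T (Suc n) x - cheb_T n x"

fun cheb_U :: "nat \<Rightarrow> real \<Rightarrow> real" where
  "cheb_U 0 x = 1"
| "cheb_U (Suc 0) x = 2 * x"
| "cheb_U (Suc (Suc n)) x = 2 * x * cheb_U (Suc n) x - cheb_U n x"

definition C_coeff :: "nat \<Rightarrow> int \<Rightarrow> real" where
  "C_coeff q k = cheb_T (nat \<bar>k\<bar>) (sqrt (real q) / 2)"

text \<open>Only arguments \<open>n \<ge> 1\<close> are meaningful; \<open>n - 1\<close> is truncated subtraction.\<close>

definition D_coeff :: "nat \<Rightarrow> nat \<Rightarrow> real" where
  "D_coeff q n = sqrt (real q) * cheb_U (n - 1) (sqrt (real q) / 2)"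

text \<open>Deletion of the \<open>j\<close>th entry, with entries numbered from 1.\<close>

definition delete_entry :: "nat \<Rightarrow> 'c list \<Rightarrow> 'c list" where
  "delete_entry j xs = take (j - 1) xs @ drop j xs"

lemma length_delete_entry:
  "1 \<le> j \<Longrightarrow> j \<le> length xs \<Longrightarrow> length (delete_entry j xs) < length xs"
  by (auto simp: delete_entry_def)

function P_star :: "nat \<Rightarrow> nat list \<Rightarrow> real" where
  "P_star q xs =
     (if xs = [] then 1
      else if \<not> successively (\<noteq>) xs then 0
      else 1 / D_coeff q (length xs + 1) *
           (\<Sum>j = 1..length xs.
              C_coeff q (int (length xs) - 2 * int j + 1) * P_star q (delete_entry j xs)))"
  by pat_completeness auto
termination
  by (relation "Wellfounded.measure (\<lambda>(q, xs). length xs)") (auto simp: length_delete_entry)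

declare P_star.simps [simp del]


section \<open>Graphs\<close>

text \<open>A simple graph is given by its vertex set \<open>V\<close> and its set \<open>E\<close> of edges, where an
  edge is the two-element set of its endpoints.\<close>

definition simple_graph :: "'v set \<Rightarrow> 'v set set \<Rightarrow> bool" where
  "simple_graph V E \<longleftrightarrow> (\<forall>e\<in>E. e \<subseteq> V \<and> card e = 2)"

definition walk :: "'v set \<Rightarrow> 'v set set \<Rightarrow> 'v list \<Rightarrow> bool" where
  "walk V E us \<longleftrightarrow> us \<noteq> [] \<and> set us \<subseteq> V \<and> successively (\<lambda>u v. {u, v} \<in> E) us"

definition is_path :: "'v set \<Rightarrow> 'v set set \<Rightarrow> 'v list \<Rightarrow> bool" where
  "is_path V E us \<longleftrightarrow> walk V E us \<and> distinct us"

definition graph_dist :: "'v set \<Rightarrow> 'v set set \<Rightarrow> 'v \<Rightarrow> 'v \<Rightarrow> enat" where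
  "graph_dist V E u v =
     (INF us \<in> {us. walk V E us \<and> hd us = u \<and> last us = v}. enat (length us - 1))"

definition set_dist :: "'v set \<Rightarrow> 'v set set \<Rightarrow> 'v set \<Rightarrow> 'v set \<Rightarrow> enat" where
  "set_dist V E A B = (INF u \<in> A. INF v \<in> B. graph_dist V E u v)"

text \<open>The spider with legs of lengths \<open>m\<close>, \<open>n\<close> and infinity: \<open>Hub\<close> is the distinguished
  vertex, and \<open>Leg i j\<close> is the \<open>j\<close>th vertex on the \<open>i\<close>th leg.\<close>

datatype vertex = Hub | Leg nat nat

definition spider_verts :: "nat \<Rightarrow> nat \<Rightarrow> vertex set" where
  "spider_verts m n =
     {Hub} \<union> {Leg 1 j | j. 1 \<le> j \<and> j \<le> m} \<union> {Leg 2 j | j. 1 \<le> j \<and> j \<le> n}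
     \<union> {Leg 3 j | j. 1 \<le> j}"

definition spider_edges :: "nat \<Rightarrow> nat \<Rightarrow> vertex set set" where
  "spider_edges m n =
     {{Hub, Leg i 1} | i. Leg i 1 \<in> spider_verts m n}
     \<union> {{Leg i j, Leg i (j + 1)} | i j.
           Leg i j \<in> spider_verts m n \<and> Leg i (j + 1) \<in> spider_verts m n}"

lemma simple_graph_spider: "simple_graph (spider_verts m n) (spider_edges m n)"
  by (auto simp: simple_graph_def spider_edges_def spider_verts_def)


section \<open>Random colorings\<close>

definition color_space :: "nat \<Rightarrow> nat measure" where
  "color_space q = count_space {1..q}"

definition restriction :: "('v \<Rightarrow> 'a \<Rightarrow> nat) \<Rightarrow> 'v set \<Rightarrow> 'a \<Rightarrow> 'v \<Rightarrow> nat" where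
  "restriction X A = (\<lambda>\<omega>. \<lambda>v\<in>A. X v \<omega>)"

text \<open>Measurability into the discrete space on \<open>{1..q}\<close> includes that \<open>X v\<close> takes its
  values in \<open>{1..q}\<close>.\<close>

definition coloring ::
  "'v set \<Rightarrow> 'v set set \<Rightarrow> nat \<Rightarrow> 'a measure \<Rightarrow> ('v \<Rightarrow> 'a \<Rightarrow> nat) \<Rightarrow> bool" where
  "coloring V E q M X \<longleftrightarrow>
     simple_graph V E \<and> prob_space M \<and>
     (\<forall>v\<in>V. X v \<in> measurable M (color_space q)) \<and>
     (\<forall>u v. {u, v} \<in> E \<longrightarrow> (AE \<omega> in M. X u \<omega> \<noteq> X v \<omega>))"

definition dependent_coloring ::
  "nat \<Rightarrow> 'v set \<Rightarrow> 'v set set \<Rightarrow> nat \<Rightarrow> 'a measure \<Rightarrow> ('v \<Rightarrow> 'a \<Rightarrow> nat) \<Rightarrow> bool" where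
  "dependent_coloring k V E q M X \<longleftrightarrow>
     coloring V E q M X \<and>
     (\<forall>A B. A \<subseteq> V \<longrightarrow> B \<subseteq> V \<longrightarrow> set_dist V E A B > enat k \<longrightarrow>
        prob_space.indep_var M
          (\<Pi>\<^sub>M v\<in>A. color_space q) (restriction X A)
          (\<Pi>\<^sub>M v\<in>B. color_space q) (restriction X B))"

definition law :: "'v set \<Rightarrow> nat \<Rightarrow> 'a measure \<Rightarrow> ('v \<Rightarrow> 'a \<Rightarrow> nat) \<Rightarrow> ('v \<Rightarrow> nat) measure" where
  "law V q M X = distr M (\<Pi>\<^sub>M v\<in>V. color_space q) (restriction X V)"

definition color_symmetric ::
  "'v set \<Rightarrow> nat \<Rightarrow> 'a measure \<Rightarrow> ('v \<Rightarrow> 'a \<Rightarrow> nat) \<Rightarrow> bool" where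
  "color_symmetric V q M X \<longleftrightarrow>
     (\<forall>\<sigma>. \<sigma> permutes {1..q} \<longrightarrow> law V q M (\<lambda>v \<omega>. \<sigma> (X v \<omega>)) = law V q M X)"

definition paths_P_star ::
  "'v set \<Rightarrow> 'v set set \<Rightarrow> nat \<Rightarrow> 'a measure \<Rightarrow> ('v \<Rightarrow> 'a \<Rightarrow> nat) \<Rightarrow> bool" where
  "paths_P_star V E q M X \<longleftrightarrow>
     (\<forall>us xs. is_path V E us \<longrightarrow> length xs = length us \<longrightarrow> set xs \<subseteq> {1..q} \<longrightarrow>
        measure M {\<omega> \<in> space M. map (\<lambda>u. X u \<omega>) us = xs} = P_star q xs)"

end

theory Submission
  imports Defs
begin

text \<open>The obstruction is a single event that is too likely. Colour the first vertices \<open>a\<close> and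
  \<open>b\<close> of the two finite legs with two different colours and the first \<open>m\<close> vertices of the infinite
  leg alternately with the two remaining colours. The hub then sees three different colours on
  its neighbours, so its colour is forced: it is the one that continues the alternating pattern
  backwards. Hence, up to a null set, the event implies that the path from \<open>a\<close> through the hub along the infinite
  leg carries a word of length \<open>m + 2\<close> which starts with one foreign colour and alternates from
  then on.

  On the other hand \<open>a\<close>, \<open>b\<close> and the infinite leg without the hub are pairwise at distance
  at least 2, so \<open>1\<close>-dependence makes them independent and the event has probability
  \<open>1/16\<close> times the weight of an alternating word of length \<open>m\<close>.

  For four colours both weights are explicit. An alternating word of length \<open>n \<ge> 1\<close> has weight
  \<open>1 / (2 (n + 1)!)\<close> (lemma \<open>P_star_alternating\<close>), because the deletion of any interior letter
  puts two equal letters side by side. An alternating word preceded by a foreign letter, of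
  total length \<open>n \<ge> 2\<close>, has weight \<open>n / (4 (n + 1)!)\<close> (lemma \<open>P_star_Cons_alternating\<close>). With
  \<open>n = m + 2\<close> the implication between the events therefore says
  \<open>1 \<le> 8 / (m + 3)\<close>, which fails from \<open>m = 6\<close> on.\<close>

section \<open>The cylinder function for four colours\<close>

lemma cheb_T_1: "cheb_T n 1 = 1"
  by (induction n "1::real" rule: cheb_T.induct) auto

lemma cheb_U_1: "cheb_U n 1 = real n + 1"
  by (induction n "1::real" rule: cheb_U.induct) auto

lemma C_coeff_4: "C_coeff 4 k = 1"
  by (simp add: C_coeff_def cheb_T_1)

lemma D_coeff_4: "n \<ge> 1 \<Longrightarrow> D_coeff 4 n = 2 * real n"
  by (simp add: D_coeff_def cheb_U_1)

lemma P_star_4: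
  assumes "xs \<noteq> []" "successively (\<noteq>) xs"
  shows "P_star 4 xs
    = (\<Sum>j = 1..length xs. P_star 4 (delete_entry j xs)) / (2 * (real (length xs) + 1))"
  using assms by (subst P_star.simps) (simp add: C_coeff_4 D_coeff_4 algebra_simps)

lemma P_star_Nil: "P_star q [] = 1"
  by (subst P_star.simps) simp

lemma P_star_singleton_4: "P_star 4 [x] = 1 / 4"
  by (subst P_star_4) (auto simp: delete_entry_def P_star_Nil)

lemma P_star_not_proper: "\<not> successively (\<noteq>) xs \<Longrightarrow> P_star q xs = 0"
  by (subst P_star.simps) auto

lemma P_star_delete_between_equal:
  assumes "2 \<le> j" "j < length xs" "xs ! (j - 2) = xs ! j"
  shows "P_star q (delete_entry j xs) = 0"
proof (rule P_star_not_proper)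
  let ?ys = "delete_entry j xs"
  have "?ys ! (j - 2) = ?ys ! (j - 1)" "Suc (j - 2) < length ?ys"
    using assms by (auto simp: delete_entry_def nth_append)
  moreover have "Suc (j - 2) = j - 1" using assms by simp
  ultimately show "\<not> successively (\<noteq>) ?ys"
    unfolding successively_conv_nth by (auto intro: exI[of _ "j - 2"])
qed

fun alternating :: "'c \<Rightarrow> 'c \<Rightarrow> nat \<Rightarrow> 'c list" where
  "alternating c d 0 = []"
| "alternating c d (Suc n) = c # alternating d c n"

lemma length_alternating [simp]: "length (alternating c d n) = n"
  by (induction c d n rule: alternating.induct) auto

lemma alternating_eq_Nil_iff [simp]: "alternating c d n = [] \<longleftrightarrow> n = 0"
  by (cases n) auto

lemma set_alternating: "set (alternating c d n) \<subseteq> {c, d}"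
  by (induction c d n rule: alternating.induct) auto

lemma take_alternating: "k \<le> n \<Longrightarrow> take k (alternating c d n) = alternating c d k"
proof (induction c d n arbitrary: k rule: alternating.induct)
  case (2 c d n)
  then show ?case by (cases k) auto
qed auto

lemma nth_alternating: "i < n \<Longrightarrow> alternating c d n ! i = (if even i then c else d)"
proof (induction c d n arbitrary: i rule: alternating.induct)
  case (2 c d n)
  then show ?case by (cases i) auto
qed auto

lemma successively_alternating: "c \<noteq> d \<Longrightarrow> successively (\<noteq>) (alternating c d n)"
  by (auto simp: successively_conv_nth nth_alternating)

lemma successively_Cons_alternating:
  "c \<noteq> d \<Longrightarrow> x \<noteq> c \<Longrightarrow> successively (\<noteq>) (x # alternating c d n)"
  by (cases n) (use successively_alternating[of c d n] in auto)

lemma delete_first: "delete_entry (Suc 0) (x # xs) = xs"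
  by (simp add: delete_entry_def)

lemma delete_last_alternating:
  "delete_entry (Suc n) (alternating c d (Suc n)) = alternating c d n"
  using take_alternating[of n "Suc n" c d] by (simp add: delete_entry_def del: alternating.simps)

lemma delete_last_Cons_alternating:
  "delete_entry (Suc (Suc n)) (x # alternating c d (Suc n)) = x # alternating c d n"
  using take_alternating[of n "Suc n" c d] by (simp add: delete_entry_def del: alternating.simps)

text \<open>Only the deletions of the two end letters contribute to the recursion, and both leave an
  alternating word; so the weight for length \<open>n + 1\<close> is the weight for length \<open>n\<close> divided
  by \<open>n + 2\<close>.\<close>

lemma P_star_alternating:
  assumes "c \<noteq> d" "n \<ge> 1"
  shows "P_star 4 (alternating c d n) = 1 / (2 * fact (n + 1))"
  using assms(2,1)
proof (induction n arbitrary: c d rule: nat_induct_at_least)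
  case base
  then show ?case by (simp add: P_star_singleton_4)
next
  case (Suc n)
  let ?xs = "alternating c d (Suc n)"
  let ?f = "\<lambda>j. P_star 4 (delete_entry j ?xs)"
  have "(\<Sum>j = 1..Suc n. ?f j) = (\<Sum>j\<in>{1, Suc n}. ?f j)"
  proof (rule sum.mono_neutral_right)
    show "\<forall>j\<in>{1..Suc n} - {1, Suc n}. ?f j = 0"
    proof
      fix j assume "j \<in> {1..Suc n} - {1, Suc n}"
      then have "2 \<le> j" "j < Suc n" by auto
      then show "?f j = 0"
        by (intro P_star_delete_between_equal) (auto simp: nth_alternating simp del: alternating.simps)
    qed
  qed auto
  also have "\<dots> = P_star 4 (alternating d c n) + P_star 4 (alternating c d n)"
    using Suc.hyps by (simp add: delete_last_alternating[simplified] delete_first)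
  also have "\<dots> = 1 / fact (n + 1)"
    using Suc by (simp del: fact_Suc)
  finally have "P_star 4 ?xs = 1 / fact (n + 1) / (2 * (real (Suc n) + 1))"
    using P_star_4[of ?xs] successively_alternating[OF \<open>c \<noteq> d\<close>, of "Suc n"]
    by (simp del: alternating.simps fact_Suc)
  also have "\<dots> = 1 / (2 * fact (Suc n + 1))"
    by (simp add: fact_Suc[of "Suc n"] del: fact_Suc)
  finally show ?case .
qed

text \<open>Deleting the foreign first letter leaves an alternating word. Deleting the second or the
  last letter leaves a word of the same kind, and any other deletion makes two equal letters
  adjacent. Total length 2 starts the induction: there the word is itself alternating.\<close>

lemma P_star_Cons_alternating:
  assumes "c \<noteq> d" "x \<noteq> c" "x \<noteq> d" "n \<ge> 1"
  shows "P_star 4 (x # alternating c d n) = (real n + 1) / (4 * fact (n + 2))"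
  using assms(4,1-3)
proof (induction n arbitrary: c d rule: nat_induct_at_least)
  case base
  then have "P_star 4 (x # alternating c d 1) = P_star 4 (alternating x c 2)"
    by (simp add: numeral_2_eq_2)
  also have "\<dots> = 1 / (2 * fact 3)"
    using base by (subst P_star_alternating) auto
  finally show ?case by (simp add: fact_numeral)
next
  case (Suc n)
  let ?xs = "x # alternating c d (Suc n)"
  let ?f = "\<lambda>j. P_star 4 (delete_entry j ?xs)"
  have delete_second: "delete_entry 2 ?xs = x # alternating d c n"
    by (simp add: delete_entry_def)
  have "(\<Sum>j = 1..Suc (Suc n). ?f j) = (\<Sum>j\<in>{1, 2, Suc (Suc n)}. ?f j)"
  proof (rule sum.mono_neutral_right)
    show "\<forall>j\<in>{1..Suc (Suc n)} - {1, 2, Suc (Suc n)}. ?f j = 0"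
    proof
      fix j assume "j \<in> {1..Suc (Suc n)} - {1, 2, Suc (Suc n)}"
      then have "3 \<le> j" "j < Suc (Suc n)" by auto
      then show "?f j = 0"
        by (intro P_star_delete_between_equal)
          (auto simp: nth_Cons' nth_alternating simp del: alternating.simps)
    qed
  qed auto
  also have "\<dots> = P_star 4 (alternating c d (Suc n))
      + (P_star 4 (x # alternating d c n) + P_star 4 (x # alternating c d n))"
    using Suc.hyps delete_second
    by (simp add: delete_last_Cons_alternating[simplified] delete_first)
  also have "\<dots> = 1 / (2 * fact (Suc n + 1))
      + ((real n + 1) / (4 * fact (n + 2)) + (real n + 1) / (4 * fact (n + 2)))"
    using Suc by (intro arg_cong2[where f = "(+)"] P_star_alternating Suc.IH) auto
  also have "\<dots> = (real n + 2) / (2 * fact (n + 2))"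
    by (simp add: field_simps del: fact_Suc)
  finally have "P_star 4 ?xs = (real n + 2) / (2 * fact (n + 2)) / (2 * (real (Suc (Suc n)) + 1))"
    using P_star_4[of ?xs] successively_Cons_alternating[OF \<open>c \<noteq> d\<close> \<open>x \<noteq> c\<close>, of "Suc n"]
    by (simp del: alternating.simps fact_Suc)
  also have "\<dots> = (real (Suc n) + 1) / (4 * fact (Suc n + 2))"
    by (simp add: fact_Suc[of "Suc (Suc n)"] field_simps del: fact_Suc)
  finally show ?case .
qed


section \<open>Independence of cylinder events\<close>

lemma graph_dist_ge_2:
  assumes "u \<noteq> v" "{u, v} \<notin> E"
  shows "graph_dist V E u v \<ge> 2"
  unfolding graph_dist_def
proof (rule INF_greatest, clarify)
  fix us assume us: "walk V E us" "u = hd us" "v = last us"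
  have "length us - 1 \<ge> 2"
  proof (rule ccontr)
    assume "\<not> length us - 1 \<ge> 2"
    then have "length us \<le> 2" by simp
    with us assms show False
      by (cases us rule: remdups_adj.cases) (auto simp: walk_def)
  qed
  then show "2 \<le> enat (length us - 1)"
    by (simp add: numeral_eq_enat)
qed

lemma set_dist_gt_1:
  assumes "\<And>u v. u \<in> A \<Longrightarrow> v \<in> B \<Longrightarrow> u \<noteq> v \<and> {u, v} \<notin> E"
  shows "set_dist V E A B > enat 1"
proof -
  have "2 \<le> set_dist V E A B"
    unfolding set_dist_def by (intro INF_greatest graph_dist_ge_2) (simp_all add: assms)
  moreover have "enat 1 < 2" by (simp add: numeral_eq_enat)
  ultimately show ?thesis by (metis order.strict_trans2)
qed

text \<open>The colouring conditions speak about whole restrictions as points of a product space, and the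
  argument uses only finitely many vertices with prescribed colours. Such an event is a cylinder
  in the product space, so independence of restrictions gives a product formula for it.\<close>

lemma sets_cylinder:
  assumes "set us \<subseteq> A"
  shows "{f \<in> space (\<Pi>\<^sub>M v\<in>A. color_space q). map f us = xs} \<in> sets (\<Pi>\<^sub>M v\<in>A. color_space q)"
  using assms
proof (induction us arbitrary: xs)
  case Nil
  then show ?case by (cases "xs = []") auto
next
  case (Cons u us)
  let ?N = "\<Pi>\<^sub>M v\<in>A. color_space q"
  show ?case
  proof (cases xs)
    case xs [simp]: (Cons x xs')
    have "(\<lambda>f. f u) \<in> measurable ?N (color_space q)"
      using Cons.prems by (intro measurable_component_singleton) auto
    then have "(\<lambda>f. f u) -` ({x} \<inter> {1..q}) \<inter> space ?N \<in> sets ?N"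
      by (rule measurable_sets) (auto simp: color_space_def)
    moreover have "(\<lambda>f. f u) -` ({x} \<inter> {1..q}) \<inter> space ?N = {f \<in> space ?N. f u = x}"
      using Cons.prems by (fastforce simp: space_PiM color_space_def dest: PiE_mem)
    moreover have "{f \<in> space ?N. map f us = xs'} \<in> sets ?N"
      using Cons by simp
    ultimately have "{f \<in> space ?N. f u = x} \<inter> {f \<in> space ?N. map f us = xs'} \<in> sets ?N"
      by auto
    also have "{f \<in> space ?N. f u = x} \<inter> {f \<in> space ?N. map f us = xs'}
        = {f \<in> space ?N. map f (u # us) = xs}" by auto
    finally show ?thesis .
  qed auto
qed

lemma vimage_restriction_cylinder:
  assumes "\<And>v. v \<in> V \<Longrightarrow> X v \<in> measurable M (color_space q)" "set us \<subseteq> A" "A \<subseteq> V"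
  shows "restriction X A -` {f \<in> space (\<Pi>\<^sub>M v\<in>A. color_space q). map f us = xs} \<inter> space M
    = {\<omega> \<in> space M. map (\<lambda>u. X u \<omega>) us = xs}"
proof -
  have "map (restriction X A \<omega>) us = map (\<lambda>u. X u \<omega>) us" for \<omega>
    using assms(2) by (auto simp: restriction_def)
  moreover have "restriction X A \<omega> \<in> space (\<Pi>\<^sub>M v\<in>A. color_space q)" if "\<omega> \<in> space M" for \<omega>
    using assms(1,3) that by (auto simp: restriction_def space_PiM dest: measurable_space)
  ultimately show ?thesis by auto
qed

lemma sets_color_event:
  assumes "coloring V E q M X" "set us \<subseteq> V"
  shows "{\<omega> \<in> space M. map (\<lambda>u. X u \<omega>) us = xs} \<in> sets M"
proof -
  have X: "X v \<in> measurable M (color_space q)" if "v \<in> V" for v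
    using assms(1) that by (auto simp: coloring_def)
  then have "restriction X V \<in> measurable M (\<Pi>\<^sub>M v\<in>V. color_space q)"
    unfolding restriction_def by (intro measurable_restrict) auto
  from measurable_sets[OF this sets_cylinder[OF assms(2), of q xs]]
  show ?thesis using vimage_restriction_cylinder[OF X assms(2)] by auto
qed

lemma dependent_coloring_prob_mult:
  assumes dep: "dependent_coloring k V E q M X"
    and V: "set us \<subseteq> V" "set vs \<subseteq> V"
    and far: "set_dist V E (set us) (set vs) > enat k"
  shows "measure M {\<omega> \<in> space M. map (\<lambda>u. X u \<omega>) us = xs \<and> map (\<lambda>v. X v \<omega>) vs = ys}
    = measure M {\<omega> \<in> space M. map (\<lambda>u. X u \<omega>) us = xs}
      * measure M {\<omega> \<in> space M. map (\<lambda>v. X v \<omega>) vs = ys}"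
proof -
  have X: "X v \<in> measurable M (color_space q)" if "v \<in> V" for v
    using dep that by (auto simp: dependent_coloring_def coloring_def)
  interpret prob_space M using dep by (auto simp: dependent_coloring_def coloring_def)
  let ?N = "\<lambda>A. \<Pi>\<^sub>M v\<in>A. color_space q"
  let ?A = "set us" and ?B = "set vs"
  let ?S = "{f \<in> space (?N ?A). map f us = xs}" and ?T = "{f \<in> space (?N ?B). map f vs = ys}"
  have "indep_var (?N ?A) (restriction X ?A) (?N ?B) (restriction X ?B)"
    using dep V far by (auto simp: dependent_coloring_def)
  then have "prob ((\<lambda>\<omega>. (restriction X ?A \<omega>, restriction X ?B \<omega>)) -` (?S \<times> ?T) \<inter> space M)
      = prob (restriction X ?A -` ?S \<inter> space M) * prob (restriction X ?B -` ?T \<inter> space M)"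
    by (rule indep_varD) (rule sets_cylinder, simp)+
  moreover have "(\<lambda>\<omega>. (restriction X ?A \<omega>, restriction X ?B \<omega>)) -` (?S \<times> ?T) \<inter> space M
      = (restriction X ?A -` ?S \<inter> space M) \<inter> (restriction X ?B -` ?T \<inter> space M)"
    by auto
  moreover have "restriction X ?A -` ?S \<inter> space M = {\<omega> \<in> space M. map (\<lambda>u. X u \<omega>) us = xs}"
    using X V(1) by (intro vimage_restriction_cylinder[where V = V]) auto
  moreover have "restriction X ?B -` ?T \<inter> space M = {\<omega> \<in> space M. map (\<lambda>v. X v \<omega>) vs = ys}"
    using X V(2) by (intro vimage_restriction_cylinder[where V = V]) auto
  moreover have "{\<omega> \<in> space M. map (\<lambda>u. X u \<omega>) us = xs \<and> map (\<lambda>v. X v \<omega>) vs = ys}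
      = {\<omega> \<in> space M. map (\<lambda>u. X u \<omega>) us = xs} \<inter> {\<omega> \<in> space M. map (\<lambda>v. X v \<omega>) vs = ys}"
    by auto
  ultimately show ?thesis by simp
qed


section \<open>The obstruction on spiders\<close>

lemma spider_edge_iff:
  "{Hub, Leg i j} \<in> spider_edges m n \<longleftrightarrow> j = 1 \<and> Leg i j \<in> spider_verts m n"
  "{Leg i j, Hub} \<in> spider_edges m n \<longleftrightarrow> j = 1 \<and> Leg i j \<in> spider_verts m n"
  "{Leg i j, Leg i' j'} \<in> spider_edges m n \<longleftrightarrow>
    i = i' \<and> (j' = j + 1 \<or> j = j' + 1) \<and> Leg i j \<in> spider_verts m n \<and> Leg i' j' \<in> spider_verts m n"
  unfolding spider_edges_def by (auto simp: doubleton_eq_iff)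

text \<open>The first vertices of the finite legs get the colours 1 and 2, and the infinite leg alternates
  3, 4, \<open>\<dots>\<close> on its first six vertices. A hub next to the colours 1, 2 and 3 must have
  colour 4, which makes the path from the first leg into the infinite one read 1 followed by an
  alternating word in 4 and 3 of length 7. The contradiction is \<open>1 / 161280 \<le> 1 / 181440\<close>. Six
  vertices are the fewest for which this comparison fails: five give an equality of the two
  weights.\<close>

lemma no_spider_coloring:
  assumes "m \<ge> 1" "n \<ge> 1"
    and dep: "dependent_coloring 1 (spider_verts m n) (spider_edges m n) 4 M X"
    and path: "paths_P_star (spider_verts m n) (spider_edges m n) 4 M X"
  shows False
proof -
  let ?V = "spider_verts m n" and ?E = "spider_edges m n"
  have col: "coloring ?V ?E 4 M X" using dep by (simp add: dependent_coloring_def)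
  then interpret prob_space M by (simp add: coloring_def)
  define ray where "ray = map (Leg 3) [1..<7]"
  have ray: "ray = [Leg 3 1, Leg 3 2, Leg 3 3, Leg 3 4, Leg 3 5, Leg 3 6]"
    by (simp add: ray_def upt_rec numeral_eq_Suc)
  let ?ev = "\<lambda>us xs. {\<omega> \<in> space M. map (\<lambda>u. X u \<omega>) us = xs}"
  let ?ab = "?ev (Leg 1 1 # Leg 2 1 # ray) (1 # 2 # alternating 3 4 6)"
  have verts: "Hub \<in> ?V" "Leg 1 1 \<in> ?V" "Leg 2 1 \<in> ?V" "set ray \<subseteq> ?V"
    using assms(1,2) by (auto simp: spider_verts_def ray)

  have P: "prob (?ev us xs) = P_star 4 xs"
    if "is_path ?V ?E us" "length xs = length us" "set xs \<subseteq> {1..4}" for us xs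
    using path that by (simp add: paths_P_star_def)
  have leaf: "prob (?ev [Leg i 1] [c]) = 1 / 4" if "Leg i 1 \<in> ?V" "c \<in> {1..4}" for i c
    using that by (subst P) (auto simp: is_path_def walk_def P_star_singleton_4)
  have "prob (?ev ray (alternating 3 4 6)) = P_star 4 (alternating 3 4 6)"
    using verts set_alternating[of 3 4 6]
    by (intro P) (auto simp: is_path_def walk_def ray spider_edge_iff)
  then have ray_prob: "prob (?ev ray (alternating 3 4 6)) = 1 / 10080"
    by (simp add: P_star_alternating fact_numeral)

  \<comment> \<open>Splitting off the two finite legs one after the other uses independence of pairs of sets
    only.\<close>
  have "set_dist ?V ?E (set [Leg 2 1]) (set ray) > enat 1"
    by (rule set_dist_gt_1) (auto simp: ray spider_edge_iff)
  from dependent_coloring_prob_mult[OF dep _ _ this, of "[2]" "alternating 3 4 6"]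
  have "prob (?ev (Leg 2 1 # ray) (2 # alternating 3 4 6)) = 1 / 4 * (1 / 10080)"
    using verts leaf[of 2 2] ray_prob by simp
  moreover have "set_dist ?V ?E (set [Leg 1 1]) (set (Leg 2 1 # ray)) > enat 1"
    by (rule set_dist_gt_1) (auto simp: ray spider_edge_iff)
  from dependent_coloring_prob_mult[OF dep _ _ this, of "[1]" "2 # alternating 3 4 6"]
  have "prob ?ab = 1 / 4 * prob (?ev (Leg 2 1 # ray) (2 # alternating 3 4 6))"
    using verts leaf[of 1 1] by simp
  ultimately have "prob ?ab = 1 / 161280" by simp

  moreover have "prob ?ab \<le> prob (?ev (Leg 1 1 # Hub # ray) (1 # alternating 4 3 7))"
  proof (rule finite_measure_mono_AE)
    have "AE \<omega> in M. X Hub \<omega> \<noteq> X (Leg i 1) \<omega>" if "Leg i 1 \<in> ?V" for i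
      using col that by (auto simp: coloring_def spider_edge_iff)
    then have "AE \<omega> in M. X Hub \<omega> \<noteq> X (Leg 1 1) \<omega> \<and> X Hub \<omega> \<noteq> X (Leg 2 1) \<omega> \<and> X Hub \<omega> \<noteq> X (Leg 3 1) \<omega>"
      using verts by (auto simp: ray)
    then show "AE \<omega> in M. \<omega> \<in> ?ab \<longrightarrow> \<omega> \<in> ?ev (Leg 1 1 # Hub # ray) (1 # alternating 4 3 7)"
    proof (rule AE_mp, intro AE_I2 impI)
      fix \<omega> assume \<omega>: "\<omega> \<in> space M" "\<omega> \<in> ?ab"
        and ne: "X Hub \<omega> \<noteq> X (Leg 1 1) \<omega> \<and> X Hub \<omega> \<noteq> X (Leg 2 1) \<omega> \<and> X Hub \<omega> \<noteq> X (Leg 3 1) \<omega>"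
      have "X Hub \<omega> \<in> {1..4}"
        using col verts(1) \<omega>(1)
        by (auto simp: coloring_def color_space_def dest!: bspec measurable_space)
      then have "X Hub \<omega> = 4"
        using \<omega>(2) ne by (auto simp: ray numeral_eq_Suc)
      then show "\<omega> \<in> ?ev (Leg 1 1 # Hub # ray) (1 # alternating 4 3 7)"
        using \<omega> by (simp add: ray numeral_eq_Suc)
    qed
    show "?ev (Leg 1 1 # Hub # ray) (1 # alternating 4 3 7) \<in> events"
      using verts by (intro sets_color_event[OF col]) auto
  qed
  moreover have "prob (?ev (Leg 1 1 # Hub # ray) (1 # alternating 4 3 7))
      = P_star 4 (1 # alternating 4 3 7)"
    using verts set_alternating[of 4 3 7]
    by (intro P) (auto simp: is_path_def walk_def ray spider_edge_iff)
  then have "prob (?ev (Leg 1 1 # Hub # ray) (1 # alternating 4 3 7)) = 1 / 181440"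
    by (simp add: P_star_Cons_alternating fact_numeral)
  ultimately show False by simp
qed

theorem proposition1p4:
  "(\<nexists>(M :: 'a measure) X.
      dependent_coloring 1 (spider_verts 1 1) (spider_edges 1 1) 4 M X \<and>
      color_symmetric (spider_verts 1 1) 4 M X \<and>
      paths_P_star (spider_verts 1 1) (spider_edges 1 1) 4 M X) \<and>
   (\<nexists>(M :: 'a measure) X.
      dependent_coloring 1 (spider_verts 1 2) (spider_edges 1 2) 4 M X \<and>
      color_symmetric (spider_verts 1 2) 4 M X \<and>
      paths_P_star (spider_verts 1 2) (spider_edges 1 2) 4 M X)"
  by (blast dest: no_spider_coloring[OF order.refl order.refl]
      no_spider_coloring[OF order.refl one_le_numeral])

end
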